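(* For every positive integer $m$ that is a multiple of $3$, the graph $R_m$ is perfect for both the star-game and the stripe-game with Maximizer responding (and Minimizer initiating).
   Context: Graphs are finite, simple and undirected. $P_3$ is the path on three vertices; copies of $P_3$ in a graph are subgraphs, not necessarily induced. $R_m$ (the rooks graph with two rows) is the graph obtained by taking two disjoint cliques of size $m$ and adding a perfect matching between them. The star-game and the stripe-game on a graph $G$ are played by two players, Maximizer and Minimizer; throughout a game one of them is the initiator and the other is the responder. In each round, the initiator chooses a vertex $v$ of the current graph such that the current graph contains at least one copy of $P_3$ with $v$ as its center vertex (in the star-game), respectively with $v$ as an end-vertex (in the stripe-game); the responder then chooses one such copy of $P_3$ in the current graph, with $v$ as its center, respectively as an end-vertex; the three vertices of that copy are removed, and the next round is played on the subgraph induced by the remaining vertices. The game ends when the remaining graph contains no copy of $P_3$. Maximizer tries to maximize, and Minimizer tries to minimize, the number of copies of $P_3$ taken. The value of the game is the number of copies taken under optimal play by both players. A graph is perfect (for a given version of the game) if under optimal play all vertices are taken, i.e. the value of the game equals $|V(G)|/3$. *)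

theory Defs
  imports Complex_Main
begin

record 'a graph =
  verts :: "'a set"
  edges :: "'a set set"

definition simple_graph :: "'a graph \<Rightarrow> bool" where
  "simple_graph G \<longleftrightarrow>
     finite (verts G) \<and> (\<forall>e \<in> edges G. e \<subseteq> verts G \<and> card e = 2)"

definition remove_verts :: "'a graph \<Rightarrow> 'a set \<Rightarrow> 'a graph" where
  "remove_verts G X =
     \<lparr>verts = verts G - X, edges = {e \<in> edges G. e \<inter> X = {}}\<rparr>"

text \<open>
  A copy of \<open>P\<^sub>3\<close> is encoded as a triple \<open>(a, c, b)\<close> with center \<open>c\<close> and end-vertices \<open>a\<close>, \<open>b\<close>.
  The triples \<open>(a, c, b)\<close> and \<open>(b, c, a)\<close> encode the same copy; this does not affect the games,
  which only look at the vertex set of the chosen copy.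
\<close>

definition P3_copies :: "'a graph \<Rightarrow> ('a \<times> 'a \<times> 'a) set" where
  "P3_copies G =
     {(a, c, b). a \<in> verts G \<and> c \<in> verts G \<and> b \<in> verts G \<and>
        a \<noteq> c \<and> c \<noteq> b \<and> a \<noteq> b \<and> {a, c} \<in> edges G \<and> {c, b} \<in> edges G}"

fun P3_verts :: "'a \<times> 'a \<times> 'a \<Rightarrow> 'a set" where
  "P3_verts (a, c, b) = {a, c, b}"

datatype version = Star | Stripe

datatype player = Maximizer | Minimizer

fun opponent :: "player \<Rightarrow> player" where
  "opponent Maximizer = Minimizer"
| "opponent Minimizer = Maximizer"

fun copies_at :: "version \<Rightarrow> 'a graph \<Rightarrow> 'a \<Rightarrow> ('a \<times> 'a \<times> 'a) set" where
  "copies_at Star G v = {(a, c, b) \<in> P3_copies G. c = v}"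
| "copies_at Stripe G v = {(a, c, b) \<in> P3_copies G. a = v \<or> b = v}"

definition initiator_moves :: "version \<Rightarrow> 'a graph \<Rightarrow> 'a set" where
  "initiator_moves ver G = {v \<in> verts G. copies_at ver G v \<noteq> {}}"

fun best_for :: "player \<Rightarrow> nat set \<Rightarrow> nat" where
  "best_for Maximizer A = Max A"
| "best_for Minimizer A = Min A"

lemma copies_at_subset: "copies_at ver G v \<subseteq> P3_copies G"
  by (cases ver) auto

lemma finite_P3_copies:
  assumes "finite (verts G)"
  shows "finite (P3_copies G)"
proof (rule finite_subset)
  show "P3_copies G \<subseteq> verts G \<times> verts G \<times> verts G"
    by (auto simp: P3_copies_def)
  show "finite (verts G \<times> verts G \<times> verts G)"
    using assms by simp
qed

lemma finite_copies_at: "finite (verts G) \<Longrightarrow> finite (copies_at ver G v)"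
  by (rule finite_subset[OF copies_at_subset finite_P3_copies])

lemma finite_initiator_moves: "finite (verts G) \<Longrightarrow> finite (initiator_moves ver G)"
  by (simp add: initiator_moves_def)

lemma initiator_moves_empty_iff: "initiator_moves ver G = {} \<longleftrightarrow> P3_copies G = {}"
  by (cases ver) (auto simp: initiator_moves_def P3_copies_def)

lemma card_remove_P3:
  assumes "finite (verts G)" "P \<in> P3_copies G"
  shows "card (verts (remove_verts G (P3_verts P))) < card (verts G)"
proof (rule psubset_card_mono)
  show "verts (remove_verts G (P3_verts P)) \<subset> verts G"
    using assms(2) by (cases P) (auto simp: P3_copies_def remove_verts_def)
qed (rule assms(1))

text \<open>
  The second argument is the responder. Finiteness of the vertex set is
  tested only to make the recursion terminate.
\<close>

function game_value :: "version \<Rightarrow> player \<Rightarrow> 'a graph \<Rightarrow> nat" where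
  "game_value ver resp G =
     (if finite (verts G) \<and> P3_copies G \<noteq> {} then
        best_for (opponent resp)
          ((\<lambda>v. best_for resp
              ((\<lambda>P. 1 + game_value ver resp (remove_verts G (P3_verts P))) ` copies_at ver G v))
            ` initiator_moves ver G)
      else 0)"
  by pat_completeness auto
termination
  by (relation "measure (\<lambda>(ver, resp, G). card (verts G))")
    (auto intro!: card_remove_P3 dest: subsetD[OF copies_at_subset] simp del: P3_verts.simps)

declare game_value.simps [simp del]

definition perfect :: "version \<Rightarrow> player \<Rightarrow> 'a graph \<Rightarrow> bool" where
  "perfect ver resp G \<longleftrightarrow> real (game_value ver resp G) = real (card (verts G)) / 3"

definition rooks_graph :: "nat \<Rightarrow> (nat \<times> bool) graph" where
  "rooks_graph m =
     \<lparr>verts = {..<m} \<times> UNIV,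
      edges = {{(i, r), (j, r)} | i j r. i < m \<and> j < m \<and> i \<noteq> j}
            \<union> {{(i, False), (i, True)} | i. i < m}\<rparr>"

lemma simple_graph_rooks_graph: "simple_graph (rooks_graph m)"
  by (auto simp: simple_graph_def rooks_graph_def card_2_iff)

lemma simple_graph_remove_verts: "simple_graph G \<Longrightarrow> simple_graph (remove_verts G X)"
  by (auto simp: simple_graph_def remove_verts_def)

end

theory Submission imports Defs begin

text \<open>
  The responder never has to leave a row. When \<open>3\<close> divides \<open>m\<close>, the two rows of the rooks graph
  partition its vertices into cliques whose sizes are multiples of \<open>3\<close>. Whichever vertex \<open>v\<close> the
  initiator names, the part of \<open>v\<close> is nonempty and hence contains two further vertices; any
  three vertices of a clique carry a copy of \<open>P\<^sub>3\<close> with \<open>v\<close> as center and another one with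
  \<open>v\<close> as end-vertex. So in either version of the game the responder can answer inside the part of
  \<open>v\<close>, and the remaining graph is again partitioned in this way (\<open>clique_partition_reply\<close>). As long
  as a vertex is left, a copy of \<open>P\<^sub>3\<close> is left too, so with this strategy everything is
  taken (\<open>clique_partition_game_value_ge\<close>). Conversely, every copy uses up three vertices, so no
  play takes more than a third of the number of vertices (\<open>three_times_game_value_le\<close>).
\<close>

lemma best_for_in:
  assumes "finite A" "A \<noteq> {}"
  shows "best_for p A \<in> A"
  using assms by (cases p) auto

lemma card_P3_verts: "P \<in> P3_copies G \<Longrightarrow> card (P3_verts P) = 3"
  by (cases P) (auto simp: P3_copies_def)

lemma P3_verts_subset: "P \<in> P3_copies G \<Longrightarrow> P3_verts P \<subseteq> verts G"
  by (cases P) (auto simp: P3_copies_def)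

lemma verts_remove_verts [simp]: "verts (remove_verts G X) = verts G - X"
  by (simp add: remove_verts_def)

lemma card_verts_remove_P3:
  assumes "finite (verts G)" "P \<in> P3_copies G"
  shows "card (verts G) = card (verts (remove_verts G (P3_verts P))) + 3"
proof -
  have "card (verts G - P3_verts P) = card (verts G) - 3"
    using assms P3_verts_subset[OF assms(2)] card_P3_verts[OF assms(2)]
    by (simp add: card_Diff_subset finite_subset)
  moreover have "3 \<le> card (verts G)"
    using card_mono[OF assms(1) P3_verts_subset[OF assms(2)]] card_P3_verts[OF assms(2)] by simp
  ultimately show ?thesis by simp
qed

text \<open>
  The copy taken in an optimal first round: with it, an induction along the game has to look at one
  successor position only, whatever the roles of the players are.
\<close>

lemma game_value_attained:
  assumes fin: "finite (verts G)" and ne: "P3_copies G \<noteq> {}"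
  shows "\<exists>P \<in> P3_copies G.
    game_value ver resp G = 1 + game_value ver resp (remove_verts G (P3_verts P))"
proof -
  let ?val = "\<lambda>P. 1 + game_value ver resp (remove_verts G (P3_verts P))"
  let ?reply = "\<lambda>v. best_for resp (?val ` copies_at ver G v)"
  let ?M = "initiator_moves ver G"
  have "?reply ` ?M \<noteq> {}" "finite (?reply ` ?M)"
    using ne fin by (auto simp: initiator_moves_empty_iff intro: finite_initiator_moves)
  then have "best_for (opponent resp) (?reply ` ?M) \<in> ?reply ` ?M"
    by (intro best_for_in)
  then obtain v where v: "v \<in> ?M" "best_for (opponent resp) (?reply ` ?M) = ?reply v"
    by auto
  from v(1) have "?val ` copies_at ver G v \<noteq> {}" "finite (?val ` copies_at ver G v)"
    using finite_copies_at[OF fin] by (auto simp: initiator_moves_def)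
  then have "?reply v \<in> ?val ` copies_at ver G v"
    by (intro best_for_in)
  then obtain P where P: "P \<in> copies_at ver G v" "?reply v = ?val P"
    by auto
  have "game_value ver resp G = best_for (opponent resp) (?reply ` ?M)"
    using fin ne by (subst game_value.simps) simp
  then show ?thesis
    using v(2) P subsetD[OF copies_at_subset P(1)] by metis
qed

lemma three_times_game_value_le:
  assumes "finite (verts G)"
  shows "3 * game_value ver resp G \<le> card (verts G)"
  using assms
proof (induction "card (verts G)" arbitrary: G rule: less_induct)
  case less
  show ?case
  proof (cases "P3_copies G = {}")
    case True
    then show ?thesis by (simp add: game_value.simps)
  next
    case False
    then obtain P where P: "P \<in> P3_copies G"
      "game_value ver resp G = 1 + game_value ver resp (remove_verts G (P3_verts P))"
      using game_value_attained[OF less.prems] by blast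
    let ?H = "remove_verts G (P3_verts P)"
    have "3 * game_value ver resp ?H \<le> card (verts ?H)"
      using less.hyps[OF card_remove_P3[OF less.prems P(1)]] less.prems by simp
    then show ?thesis
      using card_verts_remove_P3[OF less.prems P(1)] P(2) by linarith
  qed
qed

text \<open>
  A lower bound for Maximizer as responder: one good reply to every move of the initiator suffices.
\<close>

lemma game_value_Maximizer_ge:
  assumes fin: "finite (verts G)" and ne: "P3_copies G \<noteq> {}"
    and reply: "\<And>v. v \<in> verts G \<Longrightarrow> \<exists>P \<in> copies_at ver G v.
      k \<le> game_value ver Maximizer (remove_verts G (P3_verts P))"
  shows "Suc k \<le> game_value ver Maximizer G"
proof -
  let ?val = "\<lambda>P. 1 + game_value ver Maximizer (remove_verts G (P3_verts P))"
  let ?reply = "\<lambda>v. Max (?val ` copies_at ver G v)"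
  let ?M = "initiator_moves ver G"
  have ge: "Suc k \<le> ?reply v" if "v \<in> ?M" for v
  proof -
    have "v \<in> verts G" using that by (simp add: initiator_moves_def)
    from reply[OF this] obtain P where "P \<in> copies_at ver G v" "Suc k \<le> ?val P"
      by auto
    then show ?thesis
      using finite_copies_at[OF fin, of ver v] by (auto intro: order.trans[OF _ Max_ge])
  qed
  have "?M \<noteq> {}" "finite ?M"
    using ne fin by (simp_all add: initiator_moves_empty_iff finite_initiator_moves)
  then have "Suc k \<le> Min (?reply ` ?M)"
    using ge by simp
  then show ?thesis
    using fin ne by (subst game_value.simps) simp
qed

text \<open>
  The parts are the fibres of a labelling \<open>f\<close>, because a labelling, unlike a family of
  sets, need not be changed when vertices are removed.
\<close>

definition clique_partition :: "('a \<Rightarrow> 'b) \<Rightarrow> 'a graph \<Rightarrow> bool" where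
  "clique_partition f G \<longleftrightarrow>
     (\<forall>c. 3 dvd card {v \<in> verts G. f v = c}) \<and>
     (\<forall>u \<in> verts G. \<forall>v \<in> verts G. u \<noteq> v \<longrightarrow> f u = f v \<longrightarrow> {u, v} \<in> edges G)"

lemma clique_partition_two_more:
  assumes fin: "finite (verts G)" and part: "clique_partition f G" and v: "v \<in> verts G"
  obtains x y where "x \<in> verts G" "y \<in> verts G" "f x = f v" "f y = f v"
    "x \<noteq> v" "y \<noteq> v" "x \<noteq> y"
proof -
  let ?C = "{u \<in> verts G. f u = f v}"
  have C: "finite ?C" "v \<in> ?C" using fin v by auto
  then have "card ?C > 0" by (auto simp: card_gt_0_iff)
  moreover have "3 dvd card ?C" using part by (simp add: clique_partition_def)
  ultimately have "3 \<le> card ?C" using dvd_imp_le by blast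
  then have "2 \<le> card (?C - {v})" using C by simp
  then obtain T where "T \<subseteq> ?C - {v}" "card T = 2"
    by (meson obtain_subset_with_card_n)
  then obtain x y where "{x, y} \<subseteq> ?C - {v}" "x \<noteq> y"
    by (auto simp: card_2_iff)
  then show thesis using that[of x y] by auto
qed

text \<open>
  The strategy of the responder. In a clique the same three vertices carry a copy of \<open>P\<^sub>3\<close> with
  \<open>v\<close> in either position, so only the ordering of the triple depends on the version of the game.
\<close>

lemma clique_partition_reply:
  assumes fin: "finite (verts G)" and part: "clique_partition f G" and v: "v \<in> verts G"
  obtains P where "P \<in> copies_at ver G v" "clique_partition f (remove_verts G (P3_verts P))"
proof -
  obtain x y where xy: "x \<in> verts G" "y \<in> verts G" "f x = f v" "f y = f v"
    "x \<noteq> v" "y \<noteq> v" "x \<noteq> y"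
    using clique_partition_two_more[OF fin part v] .
  let ?X = "{v, x, y}"
  have adj: "{a, b} \<in> edges G" if "a \<in> ?X" "b \<in> ?X" "a \<noteq> b" for a b
    using that part xy v by (auto simp: clique_partition_def)
  have "3 dvd card {u \<in> verts G - ?X. f u = c}" for c
  proof (cases "c = f v")
    case True
    have "{u \<in> verts G - ?X. f u = c} = {u \<in> verts G. f u = c} - ?X" by auto
    moreover have "?X \<subseteq> {u \<in> verts G. f u = c}" using xy v True by auto
    ultimately have "card {u \<in> verts G - ?X. f u = c} = card {u \<in> verts G. f u = c} - card ?X"
      by (simp add: card_Diff_subset)
    moreover have "card ?X = 3" using xy by auto
    ultimately show ?thesis
      using part by (simp add: clique_partition_def dvd_diff_nat)
  next
    case False
    then have "{u \<in> verts G - ?X. f u = c} = {u \<in> verts G. f u = c}" using xy by auto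
    then show ?thesis using part by (simp add: clique_partition_def)
  qed
  then have rest: "clique_partition f (remove_verts G ?X)"
    using part by (auto simp: clique_partition_def remove_verts_def)
  show thesis
  proof (cases ver)
    case Star
    have "(x, v, y) \<in> copies_at ver G v"
      using Star xy v adj by (auto simp: P3_copies_def)
    moreover have "P3_verts (x, v, y) = ?X" by auto
    ultimately show thesis using that rest by metis
  next
    case Stripe
    have "(v, x, y) \<in> copies_at ver G v"
      using Stripe xy v adj by (auto simp: P3_copies_def)
    moreover have "P3_verts (v, x, y) = ?X" by auto
    ultimately show thesis using that rest by metis
  qed
qed

lemma clique_partition_game_value_ge:
  assumes "finite (verts G)" "clique_partition f G"
  shows "card (verts G) \<le> 3 * game_value ver Maximizer G"
  using assms
proof (induction "card (verts G)" arbitrary: G rule: less_induct)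
  case less
  show ?case
  proof (cases "verts G = {}")
    case True
    then show ?thesis by simp
  next
    case False
    \<comment> \<open>A third of the number of vertices, rounded up, minus the copy taken in this round: what the
      rest of the game must still yield.\<close>
    let ?k = "(card (verts G) - 1) div 3"
    have reply: "\<exists>P \<in> copies_at ver G v.
        ?k \<le> game_value ver Maximizer (remove_verts G (P3_verts P))"
      if v: "v \<in> verts G" for v
    proof -
      obtain P where P: "P \<in> copies_at ver G v"
        "clique_partition f (remove_verts G (P3_verts P))"
        using clique_partition_reply[OF less.prems v] .
      have P3: "P \<in> P3_copies G" by (rule subsetD[OF copies_at_subset P(1)])
      have "card (verts (remove_verts G (P3_verts P)))
          \<le> 3 * game_value ver Maximizer (remove_verts G (P3_verts P))"
        using less.hyps[OF card_remove_P3[OF less.prems(1) P3]] less.prems(1) P(2) by simp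
      then have "?k \<le> game_value ver Maximizer (remove_verts G (P3_verts P))"
        using card_verts_remove_P3[OF less.prems(1) P3] by linarith
      then show ?thesis using P(1) by blast
    qed
    have "P3_copies G \<noteq> {}"
      using False reply copies_at_subset[of ver G] by fast
    then have "Suc ?k \<le> game_value ver Maximizer G"
      using game_value_Maximizer_ge less.prems(1) reply by blast
    then show ?thesis by linarith
  qed
qed

theorem clique_partition_imp_perfect:
  assumes "finite (verts G)" "clique_partition f G"
  shows "perfect ver Maximizer G"
proof -
  have "3 * game_value ver Maximizer G = card (verts G)"
    using three_times_game_value_le[OF assms(1)] clique_partition_game_value_ge[OF assms]
    by (intro order.antisym)
  then show ?thesis
    unfolding perfect_def by linarith
qed

lemma clique_partition_rooks_graph:
  assumes "3 dvd m"
  shows "clique_partition snd (rooks_graph m)"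
proof -
  have "{v \<in> verts (rooks_graph m). snd v = r} = {..<m} \<times> {r}" for r
    by (auto simp: rooks_graph_def)
  then have "3 dvd card {v \<in> verts (rooks_graph m). snd v = r}" for r
    using assms by (simp add: card_cartesian_product)
  then show ?thesis
    by (auto simp: clique_partition_def rooks_graph_def)
qed

theorem lemma16:
  fixes m :: nat
  assumes "m > 0" and "3 dvd m"
  shows "perfect Star Maximizer (rooks_graph m) \<and> perfect Stripe Maximizer (rooks_graph m)"
proof -
  have "finite (verts (rooks_graph m))"
    using simple_graph_rooks_graph by (simp add: simple_graph_def)
  then show ?thesis
    using clique_partition_imp_perfect clique_partition_rooks_graph[OF assms(2)] by blast
qed

end
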